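(* Let $p$ be an odd prime, let $s \in \mathbb{Z}_p^{\times}$ with $\mathrm{ord}(s) = p-1$, and write $\mathrm{wt}(p)=\mathrm{wt}(p,s;p-1)$. Then $$\mathrm{wt}(p) \leq \begin{cases} \frac{p+3}{4}, & \text{if } p \equiv 1 \pmod{4}, \\ \frac{p+5}{4}, & \text{if } p \equiv 3 \pmod{4}. \end{cases}$$
   Context: $\mathbb{Z}_N$ is the ring of integers modulo $N$, $\mathbb{Z}_N^\times$ its group of units, and $\mathrm{ord}$ is multiplicative order. Let $N\ge 3$ and let $k\in\mathbb{Z}_N^\times$ have multiplicative order $\alpha\ge 2$. For a sequence of integers $\underline{i}=(i_1,\dots,i_r)$ ($r\ge 1$) with $\alpha-1\ge i_1>i_2>\dots>i_r\ge 0$ and a sequence of integers $\underline{\lambda}=(\lambda_1,\dots,\lambda_r)$ with all $\lambda_j\ge 0$, put $$\Omega(\underline{i},\underline{\lambda})=\{\,b_1k^{i_1}+\dots+b_rk^{i_r} \pmod N : b_j\in\mathbb{Z},\ |b_j|\le\lambda_j,\ 1\le j\le r\,\}\subseteq\mathbb{Z}_N .$$ Define $$\mathrm{wt}(N,k;\underline{i})=\min\{\lambda_1+\dots+\lambda_r : \Omega(\underline{i},\underline{\lambda})=\mathbb{Z}_N\},$$ and, for $1\le r\le\alpha$, let $\mathrm{wt}(N,k;r)$ be the minimum of $\mathrm{wt}(N,k;\underline{i})$ over all such sequences $\underline{i}$ of length $r$. In particular $\mathrm{wt}(N,k;\alpha)=\mathrm{wt}(N,k;\Delta)$ with $\Delta=(\alpha-1,\alpha-2,\dots,1,0)$.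 *)

theory Defs
  imports "HOL-Number_Theory.Number_Theory"
begin

text \<open>
  Elements of \<open>\<int>\<^sub>N\<close> are represented by their least nonnegative residues \<open>{0..<int N}\<close>; a unit \<open>k\<close> of
  \<open>\<int>\<^sub>N\<close> is given by any natural number coprime to \<open>N\<close> that represents it, and its multiplicative
  order is \<open>ord N k\<close>. The sequences \<open>(i\<^sub>1, \<dots>, i\<^sub>r)\<close> and \<open>(\<lambda>\<^sub>1, \<dots>, \<lambda>\<^sub>r)\<close> are lists, indexed from \<open>0\<close>.
\<close>

definition exponent_seqs :: "nat \<Rightarrow> nat \<Rightarrow> nat \<Rightarrow> nat list set" where
  "exponent_seqs N k r =
     {is. length is = r \<and> sorted_wrt (>) is \<and> (\<forall>i\<in>set is. i \<le> ord N k - 1)}"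

definition Omega :: "nat \<Rightarrow> nat \<Rightarrow> nat list \<Rightarrow> nat list \<Rightarrow> int set" where
  "Omega N k is ls =
     {(\<Sum>j<length is. b j * int k ^ (is ! j)) mod int N | b :: nat \<Rightarrow> int.
        \<forall>j<length is. \<bar>b j\<bar> \<le> int (ls ! j)}"

definition wt_seq :: "nat \<Rightarrow> nat \<Rightarrow> nat list \<Rightarrow> nat" where
  "wt_seq N k is =
     (LEAST w. \<exists>ls. length ls = length is \<and> Omega N k is ls = {0..<int N} \<and> w = sum_list ls)"

definition wt :: "nat \<Rightarrow> nat \<Rightarrow> nat \<Rightarrow> nat" where
  "wt N k r = (LEAST w. \<exists>is \<in> exponent_seqs N k r. w = wt_seq N k is)"

text \<open>
  For a unit \<open>k\<close> and \<open>1 \<le> r \<le> ord N k\<close>, both sets whose least element is taken are nonempty, so the two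
  minima are attained.
\<close>

lemma Omega_full_exists:
  assumes "N > 0" "coprime k N" "is \<noteq> []"
  shows "\<exists>ls. length ls = length is \<and> Omega N k is ls = {0..<int N}"
proof (intro exI conjI)
  show "length (replicate (length is) N) = length is" by simp
  show "Omega N k is (replicate (length is) N) = {0..<int N}"
  proof
    show "Omega N k is (replicate (length is) N) \<subseteq> {0..<int N}"
      using assms(1) by (auto simp: Omega_def)
    show "{0..<int N} \<subseteq> Omega N k is (replicate (length is) N)"
    proof
      fix x assume x: "x \<in> {0..<int N}"
      have "coprime (int k ^ (is ! 0)) (int N)" using assms(2) by simp
      then obtain u where u: "[int k ^ (is ! 0) * u = 1] (mod int N)"
        using cong_solve_coprime_int by blast
      define b where "b = (\<lambda>j::nat. if j = 0 then (x * u) mod int N else 0)"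
      have b: "\<bar>b j\<bar> \<le> int N" for j
        using assms(1) less_imp_le[OF pos_mod_bound[of "int N" "x * u"]] by (simp add: b_def)
      have sum_b: "(\<Sum>j<length is. b j * int k ^ (is ! j)) = ((x * u) mod int N) * int k ^ (is ! 0)"
      proof -
        have "(\<Sum>j<length is. b j * int k ^ (is ! j)) = (\<Sum>j\<in>{0}. b j * int k ^ (is ! j))"
          using assms(3) by (intro sum.mono_neutral_right) (auto simp: b_def)
        then show ?thesis by (simp add: b_def)
      qed
      have "((x * u) mod int N) * int k ^ (is ! 0) mod int N = (x * u * int k ^ (is ! 0)) mod int N"
        by (rule mod_mult_left_eq)
      also have "x * u * int k ^ (is ! 0) = x * (int k ^ (is ! 0) * u)"
        by (simp only: ac_simps)
      also have "\<dots> mod int N = x mod int N"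
        using cong_scalar_left[OF u, of x] by (simp only: cong_def mult_1_right)
      also have "\<dots> = x" using x by simp
      finally have "x = (\<Sum>j<length is. b j * int k ^ (is ! j)) mod int N"
        by (simp only: sum_b)
      moreover have "\<forall>j<length is. \<bar>b j\<bar> \<le> int (replicate (length is) N ! j)"
        using b by simp
      ultimately show "x \<in> Omega N k is (replicate (length is) N)"
        unfolding Omega_def by blast
    qed
  qed
qed

lemma wt_seq_attained:
  assumes "N > 0" "coprime k N" "is \<noteq> []"
  shows "\<exists>ls. length ls = length is \<and> Omega N k is ls = {0..<int N} \<and> wt_seq N k is = sum_list ls"
proof -
  let ?P = "\<lambda>w. \<exists>ls. length ls = length is \<and> Omega N k is ls = {0..<int N} \<and> w = sum_list ls"
  have "\<exists>w. ?P w" using Omega_full_exists[OF assms] by metis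
  then show ?thesis unfolding wt_seq_def by (rule LeastI_ex[of ?P])
qed

lemma wt_attained:
  assumes "r \<le> ord N k"
  shows "\<exists>is \<in> exponent_seqs N k r. wt N k r = wt_seq N k is"
proof -
  have "rev [0..<r] \<in> exponent_seqs N k r"
    using assms by (auto simp: exponent_seqs_def sorted_wrt_rev)
  then have "\<exists>w. \<exists>is \<in> exponent_seqs N k r. w = wt_seq N k is" by metis
  then show ?thesis
    unfolding wt_def by (rule LeastI_ex[of "\<lambda>w. \<exists>is \<in> exponent_seqs N k r. w = wt_seq N k is"])
qed

end

theory Submission
  imports Defs
begin

text \<open>
  Two powers of \<open>s\<close> suffice. Since \<open>s\<close> is a primitive root, both \<open>1\<close> and \<open>2\<close> are among its powers,
  and the exponents differ because \<open>p > 2\<close>. Give weight \<open>1\<close> to the first, weight \<open>p div 4\<close> to the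
  second and weight \<open>0\<close> to all other powers. The integers \<open>a + 2 * c\<close> with \<open>\<bar>a\<bar> \<le> 1\<close> and
  \<open>\<bar>c\<bar> \<le> p div 4\<close> fill the interval of radius \<open>2 * (p div 4) + 1 \<ge> (p - 1) / 2\<close> around \<open>0\<close>, which
  meets every residue class. The total weight \<open>1 + p div 4\<close> is \<open>(p + 3) / 4\<close> if
  \<open>p \<equiv> 1 (mod 4)\<close> and \<open>(p + 1) / 4\<close> if \<open>p \<equiv> 3 (mod 4)\<close>. The covering argument is
  \<open>wt_seq_le_if_one_and_two\<close>; it works for every positive modulus in which \<open>1\<close> and \<open>2\<close> are
  powers of \<open>k\<close>.
\<close>

lemma wt_seq_le:
  assumes "length ls = length is" "Omega N k is ls = {0..<int N}"
  shows "wt_seq N k is \<le> sum_list ls"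
  unfolding wt_seq_def using assms by (intro Least_le) blast

lemma wt_le_wt_seq:
  assumes "is \<in> exponent_seqs N k r"
  shows "wt N k r \<le> wt_seq N k is"
  unfolding wt_def using assms by (intro Least_le) blast

lemma sum_two_points:
  fixes f :: "'a \<Rightarrow> 'b::comm_monoid_add"
  assumes "finite A" "m \<in> A" "n \<in> A" "m \<noteq> n" "\<And>j. j \<in> A \<Longrightarrow> j \<noteq> m \<Longrightarrow> j \<noteq> n \<Longrightarrow> f j = 0"
  shows "sum f A = f m + f n"
proof -
  have "sum f A = sum f {m, n}"
    using assms by (intro sum.mono_neutral_right) auto
  then show ?thesis using assms(4) by simp
qed

text \<open>
  Dividing by \<open>2\<close> with the quotient truncated towards \<open>0\<close> keeps the remainder in \<open>{-1, 0, 1}\<close>, with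
  the sign of the dividend, so that the quotient stays in a symmetric range.
\<close>

lemma symmetric_halving:
  fixes y C :: int
  assumes "\<bar>y\<bar> \<le> 2 * C + 1"
  shows "\<exists>a c. y = a + 2 * c \<and> \<bar>a\<bar> \<le> 1 \<and> \<bar>c\<bar> \<le> C"
proof -
  define q r where "q = \<bar>y\<bar> div 2" and "r = \<bar>y\<bar> mod 2"
  have "\<bar>y\<bar> = r + 2 * q" "0 \<le> r" "r \<le> 1" "0 \<le> q" "q \<le> C"
    using assms by (auto simp: q_def r_def)
  then show ?thesis
    by (intro exI[of _ "sgn y * r"] exI[of _ "sgn y * q"]) (auto simp: sgn_if)
qed

text \<open>
  Every residue class has a representative of absolute value at most \<open>N / 2\<close>, and
  \<open>symmetric_halving\<close> writes it as \<open>a * 1 + c * 2\<close> with \<open>a\<close> and \<open>c\<close> in the allotted ranges.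
\<close>

lemma wt_seq_le_if_one_and_two:
  assumes "N > 0" and "m < length is" "n < length is" "m \<noteq> n"
    and one: "[int k ^ (is ! m) = 1] (mod int N)"
    and two: "[int k ^ (is ! n) = 2] (mod int N)"
  shows "wt_seq N k is \<le> 1 + N div 4"
proof -
  define ls where "ls = map (\<lambda>j. if j = m then 1 else if j = n then N div 4 else 0) [0..<length is]"
  have len: "length ls = length is" by (simp add: ls_def)
  have "sum_list ls = (\<Sum>j<length is. if j = m then 1 else if j = n then N div 4 else 0)"
    by (simp add: ls_def interv_sum_list_conv_sum_set_nat atLeast0LessThan)
  also have "\<dots> = 1 + N div 4"
    using assms(2-4) by (subst sum_two_points[of _ m n]) auto
  finally have weight: "sum_list ls = 1 + N div 4" .
  have "Omega N k is ls = {0..<int N}"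
  proof
    show "Omega N k is ls \<subseteq> {0..<int N}"
      using assms(1) by (auto simp: Omega_def)
    show "{0..<int N} \<subseteq> Omega N k is ls"
    proof
      fix x assume x: "x \<in> {0..<int N}"
      define y where "y = (if 2 * x < int N then x else x - int N)"
      have y_cong: "[y = x] (mod int N)" by (simp add: y_def cong_def)
      \<comment> \<open>Here \<open>\<bar>y\<bar> \<le> N / 2\<close>, and \<open>N div 2 = 2 * (N div 4)\<close> or \<open>N div 2 = 2 * (N div 4) + 1\<close>.\<close>
      have "int N \<le> 4 * int (N div 4) + 3" by linarith
      then have "\<bar>y\<bar> \<le> 2 * int (N div 4) + 1"
        using x by (auto simp: y_def)
      then obtain a c where ac: "y = a + 2 * c" "\<bar>a\<bar> \<le> 1" "\<bar>c\<bar> \<le> int (N div 4)"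
        using symmetric_halving by blast
      define b where "b = (\<lambda>j. if j = m then a else if j = n then c else 0)"
      have "(\<Sum>j<length is. b j * int k ^ (is ! j)) = a * int k ^ (is ! m) + c * int k ^ (is ! n)"
        using assms(2-4) by (subst sum_two_points[of _ m n]) (auto simp: b_def)
      also have "[\<dots> = a * 1 + c * 2] (mod int N)"
        by (intro cong_add cong_mult one two cong_refl)
      also have "a * 1 + c * 2 = y" by (simp add: ac(1))
      also note y_cong
      finally have "x = (\<Sum>j<length is. b j * int k ^ (is ! j)) mod int N"
        using x by (simp add: cong_def)
      moreover have "\<forall>j<length is. \<bar>b j\<bar> \<le> int (ls ! j)"
        using ac by (auto simp: b_def ls_def)
      ultimately show "x \<in> Omega N k is ls"
        unfolding Omega_def by blast
    qed
  qed
  from wt_seq_le[OF len this] weight show ?thesis by simp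
qed

theorem theorem3:
  fixes p s :: nat
  assumes "prime p" and "odd p"
    and "coprime s p" and "ord p s = p - 1"
  shows "real (wt p s (p - 1)) \<le>
           (if [p = 1] (mod 4) then (real p + 3) / 4 else (real p + 5) / 4)"
proof -
  have p3: "p \<ge> 3"
    using prime_ge_2_nat[OF assms(1)] assms(2) by (cases "p = 2") auto
  have "residue_primroot p s"
    using assms p3 by (simp add: residue_primroot_def totient_prime coprime_commute)
  then have "(\<lambda>i. s ^ i mod p) ` {..<p - 1} = totatives p"
    using residue_primroot_is_generator[of p s] p3 assms(1)
    by (simp add: bij_betw_def totient_prime)
  moreover have "2 \<in> totatives p"
    using p3 assms(2) by (simp add: totatives_def coprime_commute)
  ultimately obtain e where e: "e < p - 1" "s ^ e mod p = 2" by force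
  have "e \<noteq> 0" using e(2) p3 by (intro notI) simp
  define exps where "exps = rev [0..<p - 1]"
  have nth: "exps ! (p - 2 - i) = i" if "i < p - 1" for i
    using that by (simp add: exps_def rev_nth)
  have "exps \<in> exponent_seqs p s (p - 1)"
    using assms(4) by (auto simp: exps_def exponent_seqs_def sorted_wrt_rev)
  then have "wt p s (p - 1) \<le> wt_seq p s exps" by (rule wt_le_wt_seq)
  also have "\<dots> \<le> 1 + p div 4"
  proof (rule wt_seq_le_if_one_and_two)
    show "p > 0" using p3 by simp
    show "p - 2 - 0 < length exps" "p - 2 - e < length exps" "p - 2 - 0 \<noteq> p - 2 - e"
      using p3 e(1) \<open>e \<noteq> 0\<close> by (auto simp: exps_def)
    have "exps ! (p - 2 - 0) = 0" by (rule nth) (use p3 in simp)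
    then show "[int s ^ (exps ! (p - 2 - 0)) = 1] (mod int p)" by simp
    have "[s ^ e = 2] (mod p)" using e(2) p3 by (simp add: cong_def)
    then have "[int (s ^ e) = int 2] (mod int p)" by (simp only: cong_int_iff)
    then show "[int s ^ (exps ! (p - 2 - e)) = 2] (mod int p)"
      by (simp only: nth[OF e(1)] of_nat_power of_nat_numeral)
  qed
  finally have bound: "wt p s (p - 1) \<le> 1 + p div 4" .
  have "4 * (1 + p div 4) \<le> (if [p = 1] (mod 4) then p + 3 else p + 5)"
    using assms(2) unfolding cong_def by presburger
  then have "4 * wt p s (p - 1) \<le> (if [p = 1] (mod 4) then p + 3 else p + 5)"
    using mult_le_mono2[OF bound] by (rule le_trans[rotated])
  then have "real (4 * wt p s (p - 1)) \<le> real (if [p = 1] (mod 4) then p + 3 else p + 5)"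
    by (rule of_nat_mono)
  then show ?thesis by (simp split: if_splits)
qed

end
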